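(* As formal Laurent series in $q$, coefficientwise, $$\frac{1}{q}\frac{(-q;q^2)_{\infty}}{(q^3;q^2)_{\infty}}\sum_{n=0}^{\infty}\frac{(q;q^2)_n(-q)^n}{(-q;q^2)_{n}(1+q^{2n})}p_{2n}(-1;q^{-2n-1},-1:q)\equiv\frac{1}{2q}-\frac{1}{2}\pmod{4}.$$
   Context: $(a;q)_n=\prod_{j=0}^{n-1}(1-aq^j)$, $(a;q)_\infty=\prod_{j\ge0}(1-aq^j)$. The little $q$-Jacobi polynomial is $p_n(x;a,b:q)=\sum_{k\ge0}\frac{(q^{-n};q)_k(abq^{n+1};q)_k}{(q;q)_k(aq;q)_k}(qx)^k$; in particular $p_{2n}(-1;q^{-2n-1},-1:q)=\sum_{p=0}^{2n}\frac{(-1;q)_p(-q)^p}{(q;q)_p}$. *)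

theory Defs
  imports "HOL-Computational_Algebra.Formal_Laurent_Series"
begin

text \<open>All series are formal power series over the rationals, with the variable
  q represented by fps_X.  Infinite sums and products are limits in the
  (q-adic) metric topology of fps.\<close>

definition qpoch :: "rat \<Rightarrow> nat \<Rightarrow> nat \<Rightarrow> nat \<Rightarrow> rat fps" where
  "qpoch c e s n = (\<Prod>j<n. 1 - fps_const c * fps_X ^ (e + s * j))"

definition qpoch_inf :: "rat \<Rightarrow> nat \<Rightarrow> nat \<Rightarrow> rat fps" where
  "qpoch_inf c e s = lim (\<lambda>N. qpoch c e s N)"

text \<open>The specialised little q-Jacobi polynomial
  p_{2n}(-1; q^(-2n-1), -1 : q) = sum_{p=0}^{2n} (-1;q)_p (-q)^p / (q;q)_p.\<close>
definition pJ :: "nat \<Rightarrow> rat fps" where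
  "pJ n = (\<Sum>p\<le>2*n. qpoch (-1) 0 1 p * (- fps_X) ^ p / qpoch 1 1 1 p)"

definition thm_term :: "nat \<Rightarrow> rat fps" where
  "thm_term n = qpoch 1 1 2 n * (- fps_X) ^ n
      / (qpoch (-1) 1 2 n * (1 + fps_X ^ (2*n))) * pJ n"

definition thm_lhs :: "rat fls" where
  "thm_lhs = fls_X_inv * fps_to_fls
      (qpoch_inf (-1) 1 2 / qpoch_inf 1 3 2 * (\<Sum>n. thm_term n))"

definition thm_rhs :: "rat fls" where
  "thm_rhs = fls_const (1/2) * fls_X_inv - fls_const (1/2)"

end

theory Submission
  imports Defs
begin

text \<open>
  Write \<open>o(n) = q\<^sup>n / (1 - q\<^sup>2\<^sup>n)\<close> and \<open>z(c) = q\<^sup>c / (1 - q\<^sup>c)\<close>.  Since \<open>(-1;q)\<^sub>p\<close> carries a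
  factor 2 and \<open>(1 - x) / (1 + x)\<close> is 1 modulo 2, the \<open>n\<close>-th term of the series is congruent modulo 4 to
  \<open>(-q)\<^sup>n / (1 + q\<^sup>2\<^sup>n) + 2 o(n) (z(2) + z(4) + \<dots> + z(2n))\<close>.  The off-diagonal
  part of the double sum (where \<open>z(2j)\<close> meets \<open>o(n)\<close>, \<open>j < n\<close>) rearranges, with its factor 2, to \<open>2 e\<^sub>2\<close> of the
  \<open>z(c)\<close>, \<open>c\<close> odd, that is to the square of their sum minus the sum of their squares.  On the other hand, with
  \<open>v(c) = - q\<^sup>c / (1 + q\<^sup>c)\<close>, the inverse of the prefactor (without \<open>1 - q\<close>) is the product of the \<open>1 + 2 v(c)\<close>,
  and half of it is \<open>1/2 + e\<^sub>1 + 2 e\<^sub>2\<close> modulo 4 in the elementary symmetric functions of the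
  \<open>v(c)\<close>.  Modulo 4 one may exchange \<open>v(c)\<close> and \<open>z(c)\<close> in \<open>2 e\<^sub>2\<close>, and as \<open>e\<^sub>1\<close> is the alternating sum of
  the \<open>o(n)\<close>, what remains is a congruence that holds term by term in \<open>n\<close>.  So the series is
  half the inverse of its prefactor, up to the factor \<open>1 - q\<close>.
\<close>

section \<open>Congruences of power series\<close>

definition int_fps :: "rat fps set" where
  "int_fps = {f. \<forall>n. f $ n \<in> \<int>}"

lemma int_fps_0 [simp]: "0 \<in> int_fps"
  and int_fps_1 [simp]: "1 \<in> int_fps"
  and int_fps_numeral [simp]: "numeral m \<in> int_fps"
  and int_fps_X [simp]: "fps_X \<in> int_fps"
  by (auto simp: int_fps_def fps_X_def fps_numeral_nth)

lemma int_fps_add [simp]: "f \<in> int_fps \<Longrightarrow> g \<in> int_fps \<Longrightarrow> f + g \<in> int_fps"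
  and int_fps_diff [simp]: "f \<in> int_fps \<Longrightarrow> g \<in> int_fps \<Longrightarrow> f - g \<in> int_fps"
  and int_fps_minus [simp]: "f \<in> int_fps \<Longrightarrow> - f \<in> int_fps"
  by (auto simp: int_fps_def)

lemma int_fps_mult [simp]: "f \<in> int_fps \<Longrightarrow> g \<in> int_fps \<Longrightarrow> f * g \<in> int_fps"
  by (auto simp: int_fps_def fps_mult_nth intro!: Ints_sum Ints_mult)

lemma int_fps_power [simp]: "f \<in> int_fps \<Longrightarrow> f ^ n \<in> int_fps"
  by (induction n) auto

lemma int_fps_sum [simp]: "(\<And>x. x \<in> A \<Longrightarrow> f x \<in> int_fps) \<Longrightarrow> sum f A \<in> int_fps"
  by (induction A rule: infinite_finite_induct) auto

lemma int_fps_prod [simp]: "(\<And>x. x \<in> A \<Longrightarrow> f x \<in> int_fps) \<Longrightarrow> prod f A \<in> int_fps"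
  by (induction A rule: infinite_finite_induct) auto

text \<open>Since \<open>f $ 0 = 1\<close>, comparing coefficients in
  \<open>inverse f * f = 1\<close> gives \<open>inverse f $ n\<close> from the earlier coefficients
  without any division.\<close>

lemma int_fps_inverse [simp]:
  assumes "f \<in> int_fps" "f $ 0 = 1"
  shows "inverse f \<in> int_fps"
proof -
  have "inverse f $ n \<in> \<int>" for n
  proof (induction n rule: less_induct)
    case (less n)
    have "inverse f * f = 1"
      using assms by (intro inverse_mult_eq_1) simp
    hence "(1 :: rat fps) $ n = (\<Sum>i\<in>{0..n}. inverse f $ i * f $ (n - i))"
      by (simp flip: fps_mult_nth)
    also have "{0..n} = insert n {0..<n}"
      by auto
    finally have "inverse f $ n = (1 :: rat fps) $ n - (\<Sum>i\<in>{0..<n}. inverse f $ i * f $ (n - i))"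
      using assms by simp
    also have "\<dots> \<in> \<int>"
      using assms less by (intro Ints_diff Ints_sum Ints_mult) (auto simp: int_fps_def)
    finally show ?case .
  qed
  thus ?thesis
    by (simp add: int_fps_def)
qed

text \<open>The case \<open>k = 0\<close> is congruence modulo \<open>q^M\<close> alone.  The remainder \<open>r\<close> need not be integral.\<close>

definition cgr :: "int \<Rightarrow> nat \<Rightarrow> rat fps \<Rightarrow> rat fps \<Rightarrow> bool" where
  "cgr k M f g \<longleftrightarrow> (\<exists>h\<in>int_fps. \<exists>r. f - g = of_int k * h + fps_X ^ M * r)"

lemma cgrI: "f - g = of_int k * h + fps_X ^ M * r \<Longrightarrow> h \<in> int_fps \<Longrightarrow> cgr k M f g"
  unfolding cgr_def by blast

lemma cgrE:
  assumes "cgr k M f g"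
  obtains h r where "h \<in> int_fps" "f - g = of_int k * h + fps_X ^ M * r"
  using assms unfolding cgr_def by blast

lemma cgr_intI: "f - g = of_int k * h \<Longrightarrow> h \<in> int_fps \<Longrightarrow> cgr k M f g"
  by (rule cgrI[where r = 0]) auto

lemma cgr_dvdI: "fps_X ^ M dvd f - g \<Longrightarrow> cgr k M f g"
  by (metis cgrI add_0 dvdE int_fps_0 mult_zero_right)

lemma cgr_refl [simp]: "cgr k M f f"
  by (rule cgr_intI[where h = 0]) auto

lemma cgr_sym: "cgr k M f g \<Longrightarrow> cgr k M g f"
  by (elim cgrE, rule_tac h = "-h" and r = "-r" in cgrI) (auto simp: algebra_simps)

lemma cgr_add:
  assumes "cgr k M f g" "cgr k M f' g'"
  shows "cgr k M (f + f') (g + g')"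
proof -
  obtain h r where "h \<in> int_fps" "f - g = of_int k * h + fps_X ^ M * r"
    using assms by (elim cgrE)
  moreover obtain h' r' where "h' \<in> int_fps" "f' - g' = of_int k * h' + fps_X ^ M * r'"
    using assms by (elim cgrE)
  ultimately show ?thesis
    by (intro cgrI[where h = "h + h'" and r = "r + r'"]) (auto simp: algebra_simps)
qed

lemma cgr_trans [trans]: "cgr k M f g \<Longrightarrow> cgr k M g h \<Longrightarrow> cgr k M f h"
  using cgr_add[of k M f g g h] unfolding cgr_def by simp

lemma cgr_minus: "cgr k M f g \<Longrightarrow> cgr k M (- f) (- g)"
  by (elim cgrE, rule_tac h = "-h" and r = "-r" in cgrI) (auto simp: algebra_simps)

lemma cgr_diff: "cgr k M f g \<Longrightarrow> cgr k M f' g' \<Longrightarrow> cgr k M (f - f') (g - g')"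
  using cgr_add[of k M f g "-f'" "-g'"] cgr_minus[of k M f' g'] by simp

lemma cgr_sum: "(\<And>x. x \<in> A \<Longrightarrow> cgr k M (f x) (g x)) \<Longrightarrow> cgr k M (sum f A) (sum g A)"
  by (induction A rule: infinite_finite_induct) (auto intro: cgr_add)

lemma cgr_mult_left:
  assumes "cgr k M f g" "u \<in> int_fps"
  shows "cgr k M (u * f) (u * g)"
proof -
  obtain h r where hr: "h \<in> int_fps" "f - g = of_int k * h + fps_X ^ M * r"
    using assms by (elim cgrE)
  have "u * f - u * g = u * (f - g)"
    by (simp add: algebra_simps)
  thus ?thesis
    using hr assms by (intro cgrI[where h = "u * h" and r = "u * r"]) (auto simp: algebra_simps)
qed

lemma cgr_mult_0: "cgr k M f 0 \<Longrightarrow> u \<in> int_fps \<Longrightarrow> cgr k M (u * f) 0"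
  using cgr_mult_left[of k M f 0 u] by simp

text \<open>The congruence passes through \<open>f * g'\<close>, which is why integrality is asked
  of just these two factors.\<close>

lemma cgr_mult:
  assumes "cgr k M f f'" "cgr k M g g'" "f \<in> int_fps" "g' \<in> int_fps"
  shows "cgr k M (f * g) (f' * g')"
  using cgr_trans[OF cgr_mult_left[OF assms(2,3)]] cgr_mult_left[OF assms(1,4)]
  by (simp add: mult.commute)

lemma cgr_scale:
  assumes "cgr k M f g"
  shows "cgr (c * k) M (of_int c * f) (of_int c * g)"
proof -
  obtain h r where "h \<in> int_fps" "f - g = of_int k * h + fps_X ^ M * r"
    using assms by (elim cgrE)
  thus ?thesis
    by (intro cgrI[where h = h and r = "of_int c * r"])
       (auto simp: algebra_simps simp flip: right_diff_distrib)
qed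

text \<open>Behind a factor 2 it is enough to compute modulo 2.\<close>

lemma cgr_2_imp_4: "cgr 2 M f g \<Longrightarrow> cgr 4 M (2 * f) (2 * g)"
  using cgr_scale[of 2 M f g 2] by simp

lemma cgr_0_imp: "cgr 0 M f g \<Longrightarrow> cgr k M f g"
  by (elim cgrE, rule_tac h = 0 and r = r in cgrI) auto

text \<open>With \<open>f = g + 2 * h\<close> up to a multiple of \<open>q^M\<close>, both the cross
  term and \<open>(2 * h)^2\<close> are multiples of 4.\<close>

lemma cgr_square:
  assumes "cgr 2 M f g" "g \<in> int_fps"
  shows "cgr 4 M (f\<^sup>2) (g\<^sup>2)"
proof -
  obtain h r where hr: "h \<in> int_fps" "f - g = 2 * h + fps_X ^ M * r"
    using assms by (auto elim: cgrE)
  have "f = g + 2 * h + fps_X ^ M * r"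
    using hr by (simp add: algebra_simps)
  hence "f\<^sup>2 - g\<^sup>2 = 4 * (h * (g + h)) + fps_X ^ M * (r * (2 * g + 4 * h + fps_X ^ M * r))"
    by (simp add: power2_eq_square algebra_simps)
  thus ?thesis
    using hr assms by (intro cgrI[where h = "h * (g + h)"]) auto
qed

lemma cgr_prod:
  assumes "\<And>x. x \<in> A \<Longrightarrow> cgr k M (f x) (g x)"
      and "\<And>x. x \<in> A \<Longrightarrow> f x \<in> int_fps" "\<And>x. x \<in> A \<Longrightarrow> g x \<in> int_fps"
  shows "cgr k M (prod f A) (prod g A)"
  using assms by (induction A rule: infinite_finite_induct) (auto intro!: cgr_mult)

lemma cgr_nth:
  assumes "cgr k M f g" "n < M"
  shows "\<exists>z::int. (f - g) $ n = of_int k * of_int z"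
proof -
  obtain h r where hr: "h \<in> int_fps" "f - g = of_int k * h + fps_X ^ M * r"
    using assms by (elim cgrE)
  from hr have "(f - g) $ n = of_int k * h $ n"
    using \<open>n < M\<close> by (simp add: fps_X_power_mult_nth flip: fps_of_int)
  moreover obtain z where "h $ n = of_int z"
    using hr by (auto simp: int_fps_def elim: Ints_cases)
  ultimately show ?thesis by auto
qed

section \<open>Truncation and q-adic limits\<close>

lemma X_power_dvd_iff: "fps_X ^ M dvd (f :: rat fps) \<longleftrightarrow> (\<forall>n<M. f $ n = 0)"
proof
  assume "\<forall>n<M. f $ n = 0"
  hence "f = fps_X ^ M * fps_shift M f"
    by (auto simp: fps_eq_iff fps_X_power_mult_nth)
  thus "fps_X ^ M dvd f" by (metis dvd_triv_left)
qed (auto simp: fps_X_power_mult_nth elim!: dvdE)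

text \<open>Coefficient \<open>n\<close> is constant from \<open>N = n + 1\<close> on, so the limit
  is read off along the diagonal \<open>f (Suc n) $ n\<close>. The second conclusion bounds the
  error of truncating an infinite sum or product.\<close>

lemma fps_stabilising_limit:
  fixes f :: "nat \<Rightarrow> rat fps"
  assumes "\<And>N. fps_X ^ N dvd f (Suc N) - f N"
  shows "f \<longlonglongrightarrow> lim f" "fps_X ^ K dvd lim f - f K"
proof -
  define G where "G = Abs_fps (\<lambda>n. f (Suc n) $ n)"
  have *: "fps_X ^ K dvd f N - f K" if "N \<ge> K" for N K
    using that
  proof (induction N rule: dec_induct)
    case (step n)
    have "fps_X ^ K dvd f (Suc n) - f n"
      using assms[of n] step by (meson dvd_trans le_imp_power_dvd)
    from dvd_add[OF this step.IH] show ?case by simp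
  qed simp
  have nth: "f N $ n = G $ n" if "N > n" for N n
    using *[of "Suc n" N] that by (auto simp: G_def X_power_dvd_iff simp del: power_Suc)
  have lim: "f \<longlonglongrightarrow> G"
  proof (rule tendsto_fpsI)
    show "\<forall>\<^sub>F N in sequentially. f N $ n = G $ n" for n
      using eventually_gt_at_top[of n] by eventually_elim (rule nth)
  qed
  thus "f \<longlonglongrightarrow> lim f"
    by (simp add: limI)
  show "fps_X ^ K dvd lim f - f K"
    by (auto simp: X_power_dvd_iff limI[OF lim] nth)
qed

section \<open>Lambert series\<close>

text \<open>The argument is a series rather than an exponent so that one function covers z(c), at
  \<open>q^c\<close>, and v(c), at \<open>-q^c\<close>.\<close>

definition lam :: "rat fps \<Rightarrow> rat fps" where
  "lam x = x * inverse (1 - x)"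

text \<open>The sum of the odd powers of \<open>x\<close>; at \<open>q^n\<close> it is o(n).\<close>

definition olam :: "rat fps \<Rightarrow> rat fps" where
  "olam x = x * inverse (1 - x\<^sup>2)"

lemma mult_left_inverse_eq:
  fixes u :: "'a :: monoid_mult"
  shows "u * d = 1 \<Longrightarrow> d * s = t \<Longrightarrow> s = u * t"
  by (metis mult.assoc mult_1)

lemma inverse_eqs:
  fixes x :: "rat fps"
  assumes "x $ 0 = 0"
  shows "inverse (1 - x) * (1 - x) = 1" "inverse (1 + x) * (1 + x) = 1"
    "inverse (1 - x\<^sup>2) * (1 - x\<^sup>2) = 1" "inverse (1 + x\<^sup>2) * (1 + x\<^sup>2) = 1"
  using assms by (auto intro!: inverse_mult_eq_1 simp: power2_eq_square)

lemma int_fps_lam [simp]: "x \<in> int_fps \<Longrightarrow> x $ 0 = 0 \<Longrightarrow> lam x \<in> int_fps"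
  and int_fps_olam [simp]: "x \<in> int_fps \<Longrightarrow> x $ 0 = 0 \<Longrightarrow> olam x \<in> int_fps"
  by (auto simp: lam_def olam_def power2_eq_square)

text \<open>The tail of the geometric series is \<open>x^(M+1) / (1 - x)\<close>, and
  \<open>q\<close> divides \<open>x\<close>.\<close>

lemma lam_cgr_sum:
  assumes "x $ 0 = 0"
  shows "cgr 0 M (lam x) (\<Sum>d<M. x ^ Suc d)"
proof (rule cgr_dvdI)
  have "(1 - x) * (\<Sum>d<M. x ^ Suc d) = x - x ^ Suc M"
  proof (induction M)
    case (Suc M)
    show ?case
      unfolding sum.lessThan_Suc distrib_left Suc.IH by (simp add: algebra_simps)
  qed simp
  hence "(\<Sum>d<M. x ^ Suc d) = inverse (1 - x) * (x - x ^ Suc M)"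
    by (rule mult_left_inverse_eq[OF inverse_eqs(1)[OF assms]])
  hence "lam x - (\<Sum>d<M. x ^ Suc d) = inverse (1 - x) * x * x ^ M"
    by (simp add: lam_def algebra_simps)
  moreover have "fps_X dvd x"
    using X_power_dvd_iff[of 1 x] assms by simp
  ultimately show "fps_X ^ M dvd lam x - (\<Sum>d<M. x ^ Suc d)"
    by (simp add: dvd_power_same)
qed

lemma olam_cgr_sum:
  assumes "x $ 0 = 0"
  shows "cgr 0 M (olam x) (\<Sum>i<M. x ^ Suc (2 * i))"
proof (rule cgr_dvdI)
  have "(1 - x\<^sup>2) * (\<Sum>i<M. x ^ Suc (2 * i)) = x - x * x ^ M * x ^ M"
  proof (induction M)
    case (Suc M)
    have eq: "x ^ Suc (2 * M) = x * x ^ M * x ^ M"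
      by (simp only: mult_2 power_add power_Suc mult.assoc)
    show ?case
      unfolding sum.lessThan_Suc distrib_left Suc.IH eq
      by (simp add: algebra_simps power2_eq_square)
  qed simp
  hence "(\<Sum>i<M. x ^ Suc (2 * i)) = inverse (1 - x\<^sup>2) * (x - x * x ^ M * x ^ M)"
    by (rule mult_left_inverse_eq[OF inverse_eqs(3)[OF assms]])
  hence "olam x - (\<Sum>i<M. x ^ Suc (2 * i)) = inverse (1 - x\<^sup>2) * x * x ^ M * x ^ M"
    by (simp add: olam_def algebra_simps)
  moreover have "fps_X dvd x"
    using X_power_dvd_iff[of 1 x] assms by simp
  ultimately show "fps_X ^ M dvd olam x - (\<Sum>i<M. x ^ Suc (2 * i))"
    by (simp add: dvd_power_same)
qed

text \<open>The substitution \<open>n = Suc (j + d)\<close> turns the triangle into part of a box;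
  what the box has in addition are terms with \<open>n \<ge> M\<close>, which vanish by hypothesis.
  In a box all indices have the same range and can be permuted freely.\<close>

lemma triangle_cgr_box:
  assumes "\<And>j n. n \<ge> M \<Longrightarrow> cgr k M (f j n) 0"
  shows "cgr k M (\<Sum>n<M. \<Sum>j<n. f j n) (\<Sum>j<M. \<Sum>d<M. f j (Suc (j + d)))"
proof -
  have "(\<Sum>n<M. \<Sum>j<n. f j n) = (\<Sum>n<M. \<Sum>j\<in>{j. j \<in> {..<M} \<and> j < n}. f j n)"
    by (intro sum.cong) auto
  also have "\<dots> = (\<Sum>j<M. \<Sum>n\<in>{n. n \<in> {..<M} \<and> j < n}. f j n)"
    by (rule sum.swap_restrict) auto
  also have "cgr k M \<dots> (\<Sum>j<M. \<Sum>d<M. f j (Suc (j + d)))"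
  proof (rule cgr_sum)
    fix j
    have eq: "(\<Sum>d<M. f j (Suc (j + d))) = (\<Sum>n\<in>{Suc j..<Suc j + M}. f j n)"
      by (rule sum.reindex_bij_witness[of _ "\<lambda>n. n - Suc j" "\<lambda>d. Suc (j + d)"]) auto
    \<comment> \<open>The \<open>max\<close> keeps the two pieces disjoint and the split valid for
      every \<open>j\<close>.\<close>
    have "{Suc j..<Suc j + M} = {n. n \<in> {..<M} \<and> j < n} \<union> {max (Suc j) M..<Suc j + M}"
      by auto
    hence split: "(\<Sum>d<M. f j (Suc (j + d))) = (\<Sum>n\<in>{n. n \<in> {..<M} \<and> j < n}. f j n) +
        (\<Sum>n\<in>{max (Suc j) M..<Suc j + M}. f j n)"
      unfolding eq by (simp only:) (intro sum.union_disjoint; auto)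
    have "cgr k M (\<Sum>n\<in>{max (Suc j) M..<Suc j + M}. f j n) (\<Sum>n\<in>{max (Suc j) M..<Suc j + M}. 0)"
      by (intro cgr_sum assms) auto
    hence "cgr k M (\<Sum>n\<in>{max (Suc j) M..<Suc j + M}. f j n) 0"
      by simp
    from cgr_add[OF cgr_refl this]
    show "cgr k M (\<Sum>n\<in>{n. n \<in> {..<M} \<and> j < n}. f j n) (\<Sum>d<M. f j (Suc (j + d)))"
      unfolding split by (metis add_0_right cgr_sym)
  qed
  finally show ?thesis .
qed

text \<open>The triangular sum is the second elementary symmetric function, so its double is a
  square minus a sum of squares.\<close>

lemma square_sum_lessThan:
  fixes z :: "nat \<Rightarrow> 'a :: comm_ring_1"
  shows "(\<Sum>i<M. z i)\<^sup>2 = (\<Sum>i<M. (z i)\<^sup>2) + 2 * (\<Sum>k<M. \<Sum>i<k. z i * z k)"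
  by (induction M) (auto simp: power2_eq_square algebra_simps sum_distrib_left)

lemma lam_X_power_cgr_0: "M \<le> n \<Longrightarrow> 0 < n \<Longrightarrow> cgr k M (lam (fps_X ^ n)) 0"
  and olam_X_power_cgr_0: "M \<le> n \<Longrightarrow> 0 < n \<Longrightarrow> cgr k M (olam (fps_X ^ n)) 0"
  by (auto intro!: cgr_dvdI dvd_mult2 simp: lam_def olam_def le_imp_power_dvd)

text \<open>Writing \<open>n = j + d\<close>, the exponent \<open>(2i+1)n + 2bj\<close> of a monomial on the left becomes
  \<open>(2i+1)d + (2(i+b)+1)j\<close>, the exponent of a monomial on the right.\<close>

lemma lambert_rearrangement:
  "cgr 0 M (\<Sum>n<M. \<Sum>j<n. lam (fps_X ^ (2 * Suc j)) * olam (fps_X ^ Suc n))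
     (\<Sum>k<M. \<Sum>i<k. lam (fps_X ^ Suc (2 * i)) * lam (fps_X ^ Suc (2 * k)))"
    (is "cgr 0 M ?L ?R")
proof -
  have "cgr 0 M ?L (\<Sum>j<M. \<Sum>d<M. lam (fps_X ^ (2 * Suc j)) * olam (fps_X ^ Suc (Suc (j + d))))"
    by (intro triangle_cgr_box cgr_mult_0 olam_X_power_cgr_0 int_fps_lam int_fps_power) auto
  also have "cgr 0 M \<dots> (\<Sum>j<M. \<Sum>d<M. (\<Sum>b<M. (fps_X ^ (2 * Suc j)) ^ Suc b) *
      (\<Sum>i<M. (fps_X ^ Suc (Suc (j + d))) ^ Suc (2 * i)))"
    by (intro cgr_sum cgr_mult lam_cgr_sum olam_cgr_sum) auto
  also have "\<dots> = (\<Sum>j<M. \<Sum>d<M. \<Sum>b<M. \<Sum>i<M.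
      fps_X ^ (2 * Suc j * Suc b + Suc (Suc (j + d)) * Suc (2 * i)))"
    by (simp only: sum_product power_mult[symmetric] power_add[symmetric])
  also have "\<dots> = (\<Sum>(j,d,b,i)\<in>{..<M}\<times>{..<M}\<times>{..<M}\<times>{..<M}.
      fps_X ^ (2 * Suc j * Suc b + Suc (Suc (j + d)) * Suc (2 * i)))"
    by (simp add: sum.cartesian_product)
  \<comment> \<open>Both exponents equal \<open>(2i+1)(j+d+2) + 2(b+1)(j+1)\<close>; only the order
    of the four indices changes.\<close>
  also have "\<dots> = (\<Sum>(i,b,d,j)\<in>{..<M}\<times>{..<M}\<times>{..<M}\<times>{..<M}.
      fps_X ^ (Suc (2 * i) * Suc d + Suc (2 * Suc (i + b)) * Suc j))"
    by (rule sum.reindex_bij_witness[of _ "\<lambda>(i,b,d,j). (j,d,b,i)" "\<lambda>(j,d,b,i). (i,b,d,j)"])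
       (auto simp: algebra_simps)
  also have "\<dots> = (\<Sum>i<M. \<Sum>b<M. \<Sum>d<M. \<Sum>j<M.
      fps_X ^ (Suc (2 * i) * Suc d + Suc (2 * Suc (i + b)) * Suc j))"
    by (simp add: sum.cartesian_product)
  also have "\<dots> = (\<Sum>i<M. \<Sum>b<M. (\<Sum>d<M. (fps_X ^ Suc (2 * i)) ^ Suc d) *
      (\<Sum>j<M. (fps_X ^ Suc (2 * Suc (i + b))) ^ Suc j))"
    by (simp only: sum_product power_mult[symmetric] power_add[symmetric])
  also have "cgr 0 M \<dots>
      (\<Sum>i<M. \<Sum>b<M. lam (fps_X ^ Suc (2 * i)) * lam (fps_X ^ Suc (2 * Suc (i + b))))"
    by (intro cgr_sum cgr_mult cgr_sym[OF lam_cgr_sum]) auto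
  also have "cgr 0 M \<dots> ?R"
    by (intro cgr_sym[OF triangle_cgr_box] cgr_mult_0 lam_X_power_cgr_0 int_fps_lam int_fps_power) auto
  finally show ?thesis .
qed

text \<open>Expanding each summand as a geometric series and summing over the odd exponents first
  leaves, for the power \<open>n + 1\<close>, the series of odd powers of \<open>q^(n+1)\<close>
  with sign \<open>(-1)^(n+1)\<close>.\<close>

lemma lambert_alternating:
  "cgr 0 M (\<Sum>i<M. lam (- (fps_X ^ Suc (2 * i)))) (\<Sum>n<M. (-1) ^ Suc n * olam (fps_X ^ Suc n))"
proof -
  have "cgr 0 M (\<Sum>i<M. lam (- (fps_X ^ Suc (2 * i))))
      (\<Sum>i<M. \<Sum>d<M. (- (fps_X ^ Suc (2 * i))) ^ Suc d)"
    by (intro cgr_sum lam_cgr_sum) auto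
  also have "\<dots> = (\<Sum>n<M. \<Sum>i<M. (- (fps_X ^ Suc (2 * i))) ^ Suc n)"
    by (rule sum.swap)
  also have "\<dots> = (\<Sum>n<M. (-1) ^ Suc n * (\<Sum>i<M. (fps_X ^ Suc n) ^ Suc (2 * i)))"
    unfolding sum_distrib_left
    by (intro sum.cong refl, subst power_minus) (simp only: power_mult[symmetric] mult.commute)
  also have "cgr 0 M \<dots> (\<Sum>n<M. (-1) ^ Suc n * olam (fps_X ^ Suc n))"
    by (intro cgr_sum cgr_mult_left cgr_sym[OF olam_cgr_sum]) auto
  finally show ?thesis .
qed

text \<open>The difference is exactly \<open>-4 x^3 / (1 - x^2)^2\<close>, as
  \<open>(1 - x)^2 - (1 + x)^2 = -4x\<close>.\<close>

lemma lam_square: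
  assumes "x \<in> int_fps" "x $ 0 = 0"
  shows "cgr 4 M ((lam (- x))\<^sup>2) ((lam x)\<^sup>2)"
proof (rule cgr_intI)
  define u v where "u = inverse (1 - x)" and "v = inverse (1 + x)"
  have "u * (1 - x) = 1" "v * (1 + x) = 1"
    using inverse_eqs(1,2)[of x] assms by (auto simp: u_def v_def)
  hence "(-x * v)\<^sup>2 - (x * u)\<^sup>2 = 4 * (- (x ^ 3 * (u * v)\<^sup>2))"
    by algebra
  thus "(lam (- x))\<^sup>2 - (lam x)\<^sup>2 = of_int 4 * (- (x ^ 3 * (u * v)\<^sup>2))"
    by (simp add: lam_def u_def v_def)
  show "- (x ^ 3 * (u * v)\<^sup>2) \<in> int_fps"
    using assms by (auto simp: u_def v_def)
qed

text \<open>The difference is \<open>-2x / (1 - x^2)\<close>. This is the exchange of v(c) and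
  z(c).\<close>

lemma lam_minus:
  assumes "x \<in> int_fps" "x $ 0 = 0"
  shows "cgr 2 M (lam (- x)) (lam x)"
proof (rule cgr_intI)
  define u v where "u = inverse (1 - x)" and "v = inverse (1 + x)"
  have "u * (1 - x) = 1" "v * (1 + x) = 1"
    using inverse_eqs(1,2)[of x] assms by (auto simp: u_def v_def)
  hence "-x * v - x * u = 2 * (- (x * (u * v)))"
    by algebra
  thus "lam (- x) - lam x = of_int 2 * (- (x * (u * v)))"
    by (simp add: lam_def u_def v_def)
  show "- (x * (u * v)) \<in> int_fps"
    using assms by (auto simp: u_def v_def)
qed

text \<open>The two fractions differ by \<open>-2 x^3 / (1 - x^4)\<close>. Adding
  \<open>2 x^3 / (1 - x^2)^2\<close> to this, with the sign of \<open>(-1)^n\<close>, leaves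
  \<open>4 x^5\<close> or \<open>4 x^3\<close> over \<open>(1 - x^2)^2 (1 + x^2)\<close> for even
  and odd \<open>n\<close> respectively.\<close>

lemma inverse_minus_olam:
  assumes "x \<in> int_fps" "x $ 0 = 0"
  shows "cgr 2 M (x * inverse (1 + x\<^sup>2)) (olam x)"
    and "cgr 4 M ((-1) ^ n * (x * inverse (1 + x\<^sup>2)) + 2 * (olam x * lam (x\<^sup>2))) ((-1) ^ n * olam x)"
proof -
  define u v where "u = inverse (1 - x\<^sup>2)" and "v = inverse (1 + x\<^sup>2)"
  have uv: "u * (1 - x\<^sup>2) = 1" "v * (1 + x\<^sup>2) = 1"
    using inverse_eqs(3,4)[of x] assms by (auto simp: u_def v_def)
  have int: "u \<in> int_fps" "v \<in> int_fps"
    using assms by (auto simp: u_def v_def power2_eq_square)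
  have eq: "x * v - x * u = 2 * (- (x ^ 3 * (u * v)))"
    using uv by algebra
  show "cgr 2 M (x * inverse (1 + x\<^sup>2)) (olam x)"
    using eq int assms by (intro cgr_intI[where h = "- (x ^ 3 * (u * v))"]) (auto simp: olam_def u_def v_def)
  have lam: "olam x = x * u" "lam (x\<^sup>2) = x\<^sup>2 * u"
    by (simp_all add: olam_def lam_def u_def)
  have *: "(x * v - x * u) + 2 * ((x * u) * (x\<^sup>2 * u)) = 4 * (x ^ 5 * u\<^sup>2 * v)"
    "- (x * v - x * u) + 2 * ((x * u) * (x\<^sup>2 * u)) = 4 * (x ^ 3 * u\<^sup>2 * v)"
    using uv by algebra+
  define h where "h = (if even n then x ^ 5 * u\<^sup>2 * v else x ^ 3 * u\<^sup>2 * v)"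
  have "((-1) ^ n * (x * v) + 2 * (olam x * lam (x\<^sup>2))) - (-1) ^ n * olam x = of_int 4 * h"
    unfolding lam h_def using * by (cases "even n") (simp_all add: algebra_simps)
  thus "cgr 4 M ((-1) ^ n * (x * inverse (1 + x\<^sup>2)) + 2 * (olam x * lam (x\<^sup>2))) ((-1) ^ n * olam x)"
    unfolding v_def using assms int by (intro cgr_intI[where h = h]) (auto simp: h_def)
qed

text \<open>The right-hand side is e_1 + 2 e_2 in the v(c), the shape in which half the product of
  the \<open>1 + 2 v(c)\<close> appears.\<close>

lemma lambert_main:
  fixes M :: nat
  defines "V \<equiv> (\<Sum>i<M. lam (- (fps_X ^ Suc (2 * i))))"
  defines "V2 \<equiv> (\<Sum>i<M. (lam (- (fps_X ^ Suc (2 * i))))\<^sup>2)"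
  shows "cgr 4 M (\<Sum>n<M. (- fps_X) ^ Suc n * inverse (1 + fps_X ^ (2 * Suc n)) +
      2 * (olam (fps_X ^ Suc n) * (\<Sum>j<Suc n. lam (fps_X ^ (2 * Suc j)))))
    (V + V\<^sup>2 - V2)"
proof -
  define x where "x = (\<lambda>n. fps_X ^ Suc n :: rat fps)"
  define W where "W = (\<Sum>i<M. lam (x (2 * i)))"
  define W2 where "W2 = (\<Sum>i<M. (lam (x (2 * i)))\<^sup>2)"
  have x [simp]: "x n \<in> int_fps" "x n $ 0 = 0" for n
    by (auto simp: x_def)
  have xx: "fps_X ^ (2 * Suc n) = (x n)\<^sup>2" for n
    unfolding x_def by (simp only: power_mult[symmetric] mult.commute[of 2])
  have X: "fps_X ^ Suc n = x n" "(- fps_X) ^ Suc n = (- 1) ^ Suc n * x n" for n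
    by (simp_all only: x_def power_minus[of fps_X])
  let ?T = "\<Sum>n<M. \<Sum>j<n. lam (fps_X ^ (2 * Suc j)) * olam (x n)"
  \<comment> \<open>The diagonal index \<open>j = n\<close> is split off for
    \<open>inverse_minus_olam\<close>; the indices \<open>j < n\<close> form the triangle of
    \<open>lambert_rearrangement\<close>.\<close>
  have eq: "(- fps_X) ^ Suc n * inverse (1 + fps_X ^ (2 * Suc n)) +
        2 * (olam (fps_X ^ Suc n) * (\<Sum>j<Suc n. lam (fps_X ^ (2 * Suc j)))) =
      (-1) ^ Suc n * (x n * inverse (1 + (x n)\<^sup>2)) + 2 * (olam (x n) * lam ((x n)\<^sup>2)) +
        2 * (\<Sum>j<n. lam (fps_X ^ (2 * Suc j)) * olam (x n))" for n
    unfolding X xx sum.lessThan_Suc sum_distrib_right[symmetric]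
    by (simp only: distrib_left mult_ac add_ac)
  have "(\<Sum>n<M. (- fps_X) ^ Suc n * inverse (1 + fps_X ^ (2 * Suc n)) +
      2 * (olam (fps_X ^ Suc n) * (\<Sum>j<Suc n. lam (fps_X ^ (2 * Suc j))))) =
    (\<Sum>n<M. (-1) ^ Suc n * (x n * inverse (1 + (x n)\<^sup>2)) + 2 * (olam (x n) * lam ((x n)\<^sup>2))) + 2 * ?T"
    unfolding eq by (simp only: sum.distrib sum_distrib_left)
  also have "cgr 4 M \<dots> ((\<Sum>n<M. (-1) ^ Suc n * olam (x n)) + (W\<^sup>2 - W2))"
  proof (rule cgr_add)
    show "cgr 4 M (\<Sum>n<M. (-1) ^ Suc n * (x n * inverse (1 + (x n)\<^sup>2)) + 2 * (olam (x n) * lam ((x n)\<^sup>2)))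
        (\<Sum>n<M. (-1) ^ Suc n * olam (x n))"
      by (intro cgr_sum inverse_minus_olam) auto
    have "W\<^sup>2 - W2 = 2 * (\<Sum>k<M. \<Sum>i<k. lam (x (2 * i)) * lam (x (2 * k)))"
      unfolding W_def W2_def square_sum_lessThan by simp
    thus "cgr 4 M (2 * ?T) (W\<^sup>2 - W2)"
      using cgr_mult_left[OF cgr_0_imp[OF lambert_rearrangement[of M]], of 2 4] by (simp only: X int_fps_numeral)
  qed
  \<comment> \<open>So far the quadratic part is in the z(c); here it passes to the v(c).\<close>
  also have "cgr 4 M \<dots> (V + (V\<^sup>2 - V2))"
  proof (intro cgr_add cgr_diff)
    show "cgr 4 M (\<Sum>n<M. (-1) ^ Suc n * olam (x n)) V"
      unfolding V_def X(1)[symmetric] by (rule cgr_sym[OF cgr_0_imp[OF lambert_alternating]])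
    show "cgr 4 M (W\<^sup>2) (V\<^sup>2)"
      unfolding W_def V_def X by (intro cgr_square cgr_sum cgr_sym[OF lam_minus]) auto
    show "cgr 4 M W2 V2"
      unfolding W2_def V2_def X by (intro cgr_sum cgr_sym[OF lam_square]) auto
  qed
  finally show ?thesis by (simp add: algebra_simps)
qed

section \<open>The terms of the series\<close>

lemma fps_const_minus_1: "fps_const (- 1) = (- 1 :: rat fps)"
  by (simp flip: fps_const_neg)

lemma int_fps_qpoch [simp]: "qpoch 1 e s n \<in> int_fps" "qpoch (-1) e s n \<in> int_fps"
  by (auto simp: qpoch_def fps_const_minus_1 intro!: int_fps_prod)

lemma qpoch_nth_0 [simp]: "e > 0 \<Longrightarrow> qpoch c e s n $ 0 = 1"
  by (auto simp: qpoch_def fps_prod_nth')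

lemma qpoch_Suc: "qpoch c e s (Suc n) = qpoch c e s n * (1 - fps_const c * fps_X ^ (e + s * n))"
  by (simp add: qpoch_def)

lemma qpoch_Suc_shift: "qpoch c e s (Suc n) = (1 - fps_const c * fps_X ^ e) * qpoch c (e + s) s n"
  by (simp add: qpoch_def prod.lessThan_Suc_shift add.assoc del: prod.lessThan_Suc)

text \<open>Factor by factor, \<open>(1 - x) / (1 + x) = 1 - 2x / (1 + x)\<close>.\<close>

lemma qpoch_quotient:
  "qpoch 1 1 2 n * inverse (qpoch (-1) 1 2 n) = (\<Prod>i<n. 1 + 2 * lam (- (fps_X ^ Suc (2 * i))))"
proof (induction n)
  case (Suc n)
  define x where "x = (fps_X ^ Suc (2 * n) :: rat fps)"
  have "inverse (1 + x) * (1 + x) = 1"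
    by (rule inverse_eqs) (simp add: x_def)
  hence eq: "(1 - x) * inverse (1 + x) = 1 + 2 * lam (- x)"
    unfolding lam_def by (simp add: algebra_simps)
  have Suc_eqs: "qpoch 1 1 2 (Suc n) = qpoch 1 1 2 n * (1 - x)"
    "qpoch (-1) 1 2 (Suc n) = qpoch (-1) 1 2 n * (1 + x)"
    by (simp_all add: qpoch_Suc x_def fps_const_minus_1)
  show ?case
    unfolding Suc_eqs fps_inverse_mult prod.lessThan_Suc Suc.IH[symmetric] x_def[symmetric] eq[symmetric]
    by (simp only: mult_ac)
qed (simp add: qpoch_def)

lemma prod_1_plus_2_cgr_4:
  fixes n :: nat
  assumes "\<And>i. v i \<in> int_fps"
  shows "cgr 4 M (\<Prod>i<n. 1 + 2 * v i) (1 + 2 * (\<Sum>i<n. v i))"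
proof -
  have "\<exists>h\<in>int_fps. (\<Prod>i<n. 1 + 2 * v i) - (1 + 2 * (\<Sum>i<n. v i)) = 4 * h"
  proof (induction n)
    case (Suc n)
    then obtain h where h: "h \<in> int_fps" "(\<Prod>i<n. 1 + 2 * v i) - (1 + 2 * (\<Sum>i<n. v i)) = 4 * h"
      by auto
    \<comment> \<open>The new error is the product of \<open>2 * (\<Sum>i<n. v i)\<close> with
      \<open>2 * v n\<close>.\<close>
    hence "(\<Prod>i<Suc n. 1 + 2 * v i) - (1 + 2 * (\<Sum>i<Suc n. v i)) =
        4 * (h * (1 + 2 * v n) + (\<Sum>i<n. v i) * v n)"
      unfolding prod.lessThan_Suc sum.lessThan_Suc by algebra
    moreover have "h * (1 + 2 * v n) + (\<Sum>i<n. v i) * v n \<in> int_fps"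
      using h assms by simp
    ultimately show ?case by blast
  qed (auto intro!: bexI[of _ 0])
  thus ?thesis
    by (auto intro: cgr_intI)
qed

text \<open>The product is 1 + 2 e_1 + 4 e_2 + 8 e_3 + ..., so its half is known modulo 4 only if
  e_2 is kept.\<close>

lemma half_prod_1_plus_2_cgr_4:
  fixes n :: nat
  assumes "\<And>i. v i \<in> int_fps"
  shows "cgr 4 M (fps_const (1/2) * (\<Prod>i<n. 1 + 2 * v i))
    (fps_const (1/2) + (\<Sum>i<n. v i) + (\<Sum>i<n. v i)\<^sup>2 - (\<Sum>i<n. (v i)\<^sup>2))"
proof -
  have half: "fps_const (1/2) * 2 = (1 :: rat fps)"
    by (simp add: numeral_fps_const)
  have "\<exists>h\<in>int_fps. fps_const (1/2) * (\<Prod>i<n. 1 + 2 * v i) -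
      (fps_const (1/2) + (\<Sum>i<n. v i) + (\<Sum>i<n. v i)\<^sup>2 - (\<Sum>i<n. (v i)\<^sup>2)) = 4 * h"
  proof (induction n)
    case (Suc n)
    \<comment> \<open>Multiplying 2 e_2 by \<open>2 * v n\<close> gives the new error
      \<open>4 * ?E * v n\<close>; the product of e_1 with \<open>2 * v n\<close> updates 2
      e_2.\<close>
    let ?E = "\<Sum>k<n. \<Sum>i<k. v i * v k"
    obtain h where h: "h \<in> int_fps" "fps_const (1/2) * (\<Prod>i<n. 1 + 2 * v i) -
      (fps_const (1/2) + (\<Sum>i<n. v i) + (\<Sum>i<n. v i)\<^sup>2 - (\<Sum>i<n. (v i)\<^sup>2)) = 4 * h"
      using Suc by auto
    hence "fps_const (1/2) * (\<Prod>i<Suc n. 1 + 2 * v i) -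
        (fps_const (1/2) + (\<Sum>i<Suc n. v i) + (\<Sum>i<Suc n. v i)\<^sup>2 - (\<Sum>i<Suc n. (v i)\<^sup>2)) =
        4 * (h * (1 + 2 * v n) + ?E * v n)"
      using square_sum_lessThan[of v n] half unfolding prod.lessThan_Suc sum.lessThan_Suc by algebra
    moreover have "h * (1 + 2 * v n) + ?E * v n \<in> int_fps"
      using h assms by simp
    ultimately show ?case by blast
  qed (auto intro!: bexI[of _ 0])
  thus ?thesis
    by (auto intro: cgr_intI)
qed

text \<open>The minus signs are removed here so that the sum can be combined with the one from
  \<open>pJ\<close>.\<close>

lemma qpoch_quotient_cgr_4:
  "cgr 4 M (qpoch 1 1 2 n * inverse (qpoch (-1) 1 2 n)) (1 + 2 * (\<Sum>i<n. lam (fps_X ^ Suc (2 * i))))"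
proof -
  have "cgr 4 M (qpoch 1 1 2 n * inverse (qpoch (-1) 1 2 n)) (1 + 2 * (\<Sum>i<n. lam (- (fps_X ^ Suc (2 * i)))))"
    unfolding qpoch_quotient by (rule prod_1_plus_2_cgr_4) simp
  also have "cgr 4 M \<dots> (1 + 2 * (\<Sum>i<n. lam (fps_X ^ Suc (2 * i))))"
    by (intro cgr_add cgr_2_imp_4 cgr_sum lam_minus) auto
  finally show ?thesis .
qed

lemma cgr_4_minus_2: "f \<in> int_fps \<Longrightarrow> cgr 4 M ((-1) ^ n * (2 * f)) (2 * f)"
  by (cases "even n") (auto intro!: cgr_intI[where h = "-f"])

text \<open>The first factor of \<open>(-1;q)_(p+1)\<close> is 2, leaving \<open>(-q;q)_p\<close>,
  which modulo 2 cancels against \<open>(q;q)_p\<close>. What remains of the denominator is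
  \<open>1 - q^(p+1)\<close>, and the sign is lost because 2 = -2 modulo 4.\<close>

lemma pJ_term_cgr_4:
  "cgr 4 M (qpoch (-1) 0 1 (Suc p) * (- fps_X) ^ Suc p / qpoch 1 1 1 (Suc p)) (2 * lam (fps_X ^ Suc p))"
proof -
  let ?N = "qpoch (-1) 1 1 p" and ?D = "qpoch 1 1 1 p"
  have "cgr 2 M (1 - fps_const (-1) * x) (1 - fps_const 1 * x)" if "x \<in> int_fps" for x
    using that by (intro cgr_intI[where h = x]) (simp_all add: fps_const_minus_1)
  hence "cgr 2 M ?N ?D"
    unfolding qpoch_def by (intro cgr_prod) (simp_all add: fps_const_minus_1)
  hence "cgr 2 M (lam (fps_X ^ Suc p) * inverse ?D * ?N) (lam (fps_X ^ Suc p) * inverse ?D * ?D)"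
    by (intro cgr_mult_left) auto
  hence "cgr 4 M (2 * (lam (fps_X ^ Suc p) * inverse ?D * ?N)) (2 * (lam (fps_X ^ Suc p) * inverse ?D * ?D))"
    by (rule cgr_2_imp_4)
  also have "lam (fps_X ^ Suc p) * inverse ?D * ?D = lam (fps_X ^ Suc p)"
    by (simp add: mult.assoc inverse_mult_eq_1)
  finally have *: "cgr 4 M (2 * (lam (fps_X ^ Suc p) * inverse ?D * ?N)) (2 * lam (fps_X ^ Suc p))" .
  have "qpoch (-1) 0 1 (Suc p) * (- fps_X) ^ Suc p / qpoch 1 1 1 (Suc p) =
     (2 * ?N) * ((-1) ^ Suc p * fps_X ^ Suc p) * (inverse ?D * inverse (1 - fps_X ^ Suc p))"
    by (subst fps_divide_unit, simp, subst qpoch_Suc_shift, subst qpoch_Suc, subst power_minus)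
       (simp add: fps_inverse_mult fps_const_minus_1 del: power_Suc)
  also have "\<dots> = (-1) ^ Suc p * (2 * (lam (fps_X ^ Suc p) * inverse ?D * ?N))"
    unfolding lam_def by (simp only: mult_ac)
  also have "cgr 4 M \<dots> (2 * (lam (fps_X ^ Suc p) * inverse ?D * ?N))"
    by (intro cgr_4_minus_2) auto
  also note *
  finally show ?thesis .
qed

lemma pJ_cgr_4: "cgr 4 M (pJ n) (1 + 2 * (\<Sum>p<2*n. lam (fps_X ^ Suc p)))"
proof -
  have "pJ n = 1 + (\<Sum>p<2*n. qpoch (-1) 0 1 (Suc p) * (- fps_X) ^ Suc p / qpoch 1 1 1 (Suc p))"
    unfolding pJ_def sum.atMost_shift by (simp add: qpoch_def)
  also have "cgr 4 M \<dots> (1 + (\<Sum>p<2*n. 2 * lam (fps_X ^ Suc p)))"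
    by (intro cgr_add cgr_sum pJ_term_cgr_4 cgr_refl)
  finally show ?thesis by (simp add: sum_distrib_left)
qed

lemma int_fps_divide [simp]: "f \<in> int_fps \<Longrightarrow> g \<in> int_fps \<Longrightarrow> g $ 0 = 1 \<Longrightarrow> f / g \<in> int_fps"
  by (simp add: fps_divide_unit)

lemma int_fps_pJ [simp]: "pJ n \<in> int_fps"
  unfolding pJ_def by (intro int_fps_sum int_fps_divide) (auto simp del: One_nat_def)

text \<open>In \<open>(q;q\<^sup>2)\<^sub>n / (-q;q\<^sup>2)\<^sub>n\<close> times \<open>pJ n\<close>, the odd-index terms occur twice and cancel modulo 4.\<close>

lemma thm_term_cgr_4:
  "cgr 4 M (thm_term (Suc n)) ((- fps_X) ^ Suc n * inverse (1 + fps_X ^ (2 * Suc n)) +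
     2 * (olam (fps_X ^ Suc n) * (\<Sum>j<Suc n. lam (fps_X ^ (2 * Suc j)))))"
proof -
  let ?m = "Suc n"
  let ?Q = "qpoch 1 1 2 ?m * inverse (qpoch (-1) 1 2 ?m)"
  let ?A = "\<Sum>i<?m. lam (fps_X ^ Suc (2 * i))" and ?E = "\<Sum>j<?m. lam (fps_X ^ (2 * Suc j))"
  let ?B = "\<Sum>p<2*?m. lam (fps_X ^ Suc p)"
  let ?c = "(- fps_X) ^ ?m * inverse (1 + fps_X ^ (2 * ?m)) :: rat fps"
  have c: "?c \<in> int_fps" by simp
  have split: "(\<Sum>p<2*k. lam (fps_X ^ Suc p)) =
      (\<Sum>i<k. lam (fps_X ^ Suc (2 * i))) + (\<Sum>j<k. lam (fps_X ^ (2 * Suc j)))" for k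
    by (induction k) (simp_all add: algebra_simps)
  have "cgr 4 M (?Q * pJ ?m) ((1 + 2 * ?A) * (1 + 2 * ?B))"
    by (intro cgr_mult qpoch_quotient_cgr_4 pJ_cgr_4) (auto simp del: sum.lessThan_Suc)
  also have "cgr 4 M \<dots> (1 + 2 * ?E)"
    unfolding split[of ?m]
    by (rule cgr_intI[where h = "?A + ?A * (?A + ?E)"]) (auto simp: algebra_simps simp del: sum.lessThan_Suc)
  finally have "cgr 4 M (?c * (?Q * pJ ?m)) (?c * (1 + 2 * ?E))"
    using c by (rule cgr_mult_left)
  also have "?c * (?Q * pJ ?m) = thm_term ?m"
    unfolding thm_term_def
    by (subst fps_divide_unit) (simp_all add: fps_inverse_mult mult_ac del: power_Suc)
  also have "?c * (1 + 2 * ?E) = ?c + 2 * (?E * ?c)"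
    by (simp add: algebra_simps del: sum.lessThan_Suc)
  also have "cgr 4 M \<dots> (?c + 2 * (?E * olam (fps_X ^ ?m)))"
  \<comment> \<open>Modulo 2 the sign disappears and \<open>1 + x^2\<close> may be replaced by
    \<open>1 - x^2\<close>.\<close>
  proof (intro cgr_add cgr_refl cgr_2_imp_4 cgr_mult_left)
    have "cgr 2 M ((-1) ^ ?m * (fps_X ^ ?m * inverse (1 + (fps_X ^ ?m)\<^sup>2))) (fps_X ^ ?m * inverse (1 + (fps_X ^ ?m)\<^sup>2))"
      by (cases "even ?m") (auto intro!: cgr_intI[where h = "- (fps_X ^ ?m * inverse (1 + (fps_X ^ ?m)\<^sup>2))"])
    also have "cgr 2 M \<dots> (olam (fps_X ^ ?m))"
      by (rule inverse_minus_olam) auto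
    also have "(-1) ^ ?m * (fps_X ^ ?m * inverse (1 + (fps_X ^ ?m)\<^sup>2)) = ?c"
      by (subst (2) power_minus) (simp only: mult.assoc power_mult[symmetric] mult.commute[of 2])
    finally show "cgr 2 M ?c (olam (fps_X ^ ?m))" .
  qed (auto simp del: sum.lessThan_Suc)
  finally show ?thesis by (simp only: mult.commute)
qed

text \<open>The term \<open>n = 0\<close> is exactly 1/2 because \<open>1 + q^0 = 2\<close>. The
  next \<open>M\<close> terms match a product of \<open>M\<close> factors, hence the range
  \<open>Suc M\<close>.\<close>

lemma thm_term_sum_cgr_4:
  "cgr 4 M (\<Sum>n<Suc M. thm_term n) (fps_const (1/2) * (qpoch 1 1 2 M * inverse (qpoch (-1) 1 2 M)))"
proof -
  have 0: "thm_term 0 = fps_const (1/2)"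
    by (simp add: thm_term_def pJ_def qpoch_def numeral_fps_const fps_const_inverse fps_divide_unit)
  have "(\<Sum>n<Suc M. thm_term n) = fps_const (1/2) + (\<Sum>n<M. thm_term (Suc n))"
    by (simp add: sum.lessThan_Suc_shift 0 del: sum.lessThan_Suc)
  also have "cgr 4 M \<dots> (fps_const (1/2) + (\<Sum>n<M. (- fps_X) ^ Suc n * inverse (1 + fps_X ^ (2 * Suc n)) +
      2 * (olam (fps_X ^ Suc n) * (\<Sum>j<Suc n. lam (fps_X ^ (2 * Suc j))))))"
    by (intro cgr_add cgr_refl cgr_sum thm_term_cgr_4)
  also have "cgr 4 M \<dots> (fps_const (1/2) + ((\<Sum>i<M. lam (- (fps_X ^ Suc (2 * i)))) +
      (\<Sum>i<M. lam (- (fps_X ^ Suc (2 * i))))\<^sup>2 - (\<Sum>i<M. (lam (- (fps_X ^ Suc (2 * i))))\<^sup>2)))"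
    by (intro cgr_add cgr_refl lambert_main)
  also have "cgr 4 M \<dots> (fps_const (1/2) * (qpoch 1 1 2 M * inverse (qpoch (-1) 1 2 M)))"
    unfolding qpoch_quotient
    using cgr_sym[OF half_prod_1_plus_2_cgr_4[of "\<lambda>i. lam (- (fps_X ^ Suc (2 * i)))" M M]]
    by (simp add: add.assoc add_diff_eq)
  finally show ?thesis .
qed

section \<open>The limit\<close>

text \<open>The factor with index \<open>N\<close> differs from 1 by a multiple of
  \<open>q^(e + s*N)\<close>, and \<open>e + s*N \<ge> N\<close>.\<close>

lemma qpoch_inf_dvd: "1 \<le> s \<Longrightarrow> fps_X ^ K dvd qpoch_inf c e s - qpoch c e s K"
  unfolding qpoch_inf_def
proof (rule fps_stabilising_limit)
  fix N assume "1 \<le> s"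
  have "qpoch c e s (Suc N) - qpoch c e s N = fps_X ^ (e + s * N) * (- fps_const c * qpoch c e s N)"
    by (simp add: qpoch_Suc algebra_simps flip: fps_const_neg)
  moreover have "N \<le> e + s * N"
    using \<open>1 \<le> s\<close> by (simp add: trans_le_add2)
  ultimately show "fps_X ^ N dvd qpoch c e s (Suc N) - qpoch c e s N"
    by (simp add: le_imp_power_dvd dvd_mult2)
qed

lemma suminf_thm_term_dvd: "fps_X ^ K dvd suminf thm_term - (\<Sum>n<K. thm_term n)"
proof -
  have "fps_X ^ N dvd thm_term N" for N
  proof -
    \<comment> \<open>This constant term is 2 for \<open>N = 0\<close> and 1 otherwise.\<close>
    have "(qpoch (-1) 1 2 N * (1 + fps_X ^ (2 * N))) $ 0 \<noteq> 0"
      by simp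
    moreover have "fps_X ^ N dvd ((- fps_X) ^ N :: rat fps)"
      by (subst power_minus) simp
    ultimately show ?thesis
      unfolding thm_term_def by (simp add: fps_divide_unit dvd_mult dvd_mult2)
  qed
  hence "fps_X ^ N dvd (\<Sum>n<Suc N. thm_term n) - (\<Sum>n<N. thm_term n)" for N
    by simp
  note lim = fps_stabilising_limit[of "\<lambda>N. \<Sum>n<N. thm_term n", OF this]
  from lim(1) have "suminf thm_term = lim (\<lambda>N. \<Sum>n<N. thm_term n)"
    by (simp add: sums_def sums_unique[symmetric])
  with lim(2) show ?thesis by simp
qed

lemma dvd_diff_mult:
  fixes x :: "'a :: comm_ring_1"
  assumes "x dvd a - a'" "x dvd b - b'"
  shows "x dvd a * b - a' * b'"
proof -
  have "a * b - a' * b' = a * (b - b') + (a - a') * b'"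
    by (simp add: algebra_simps)
  thus ?thesis using assms by (simp add: dvd_mult dvd_mult2)
qed

text \<open>After truncation at \<open>K\<close> the numerator of the prefactor cancels, and the
  quotient of \<open>(q;q^2)_K\<close> by \<open>(q^3;q^2)_K\<close> is
  \<open>(1 - q) / (1 - q^(2K+1))\<close>.\<close>

lemma thm_series_cgr_4:
  "cgr 4 K (qpoch_inf (-1) 1 2 / qpoch_inf 1 3 2 * suminf thm_term) (fps_const (1/2) * (1 - fps_X))"
proof (cases "K = 0")
  case False
  define P Q where "P = qpoch (-1) 1 2 K" and "Q = qpoch 1 3 2 K"
  let ?P = "qpoch_inf (-1) 1 2" and ?Q = "qpoch_inf 1 3 2" and ?S = "\<Sum>n<Suc K. thm_term n"
  have Q0: "Q $ 0 = 1" "P $ 0 = 1"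
    by (auto simp: P_def Q_def)
  have "fps_X ^ K dvd ?Q - Q"
    unfolding Q_def by (rule qpoch_inf_dvd) simp
  \<comment> \<open>Here \<open>K > 0\<close> matters: a congruence modulo \<open>q^0\<close> says
    nothing about the constant term.\<close>
  hence Q0': "?Q $ 0 = 1"
    using False Q0 by (auto simp: X_power_dvd_iff)
  have "inverse ?Q - inverse Q = - (inverse ?Q * inverse Q * (?Q - Q))"
    using inverse_mult_eq_1[of ?Q] inverse_mult_eq_1[of Q] Q0 Q0'
    by (simp add: algebra_simps)
  hence invQ: "fps_X ^ K dvd inverse ?Q - inverse Q"
    using \<open>fps_X ^ K dvd ?Q - Q\<close> by simp
  have "fps_X ^ K dvd ?P * inverse ?Q * suminf thm_term - P * inverse Q * ?S"
    unfolding P_def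
    by (intro dvd_diff_mult qpoch_inf_dvd invQ dvd_trans[OF le_imp_power_dvd suminf_thm_term_dvd]) auto
  hence "cgr 4 K (?P / ?Q * suminf thm_term) (P * inverse Q * ?S)"
    using Q0' by (intro cgr_dvdI) (simp add: fps_divide_unit)
  also have "cgr 4 K \<dots> (P * inverse Q * (fps_const (1/2) * (qpoch 1 1 2 K * inverse P)))"
    unfolding P_def Q_def by (intro cgr_mult_left thm_term_sum_cgr_4) auto
  also have "P * inverse Q * (fps_const (1/2) * (qpoch 1 1 2 K * inverse P)) =
      fps_const (1/2) * inverse Q * qpoch 1 1 2 K * (inverse P * P)"
    by (simp only: mult_ac)
  also have "inverse P * P = 1"
    using Q0 by (intro inverse_mult_eq_1) simp
  also have "cgr 4 K (fps_const (1/2) * inverse Q * qpoch 1 1 2 K * 1) (fps_const (1/2) * (1 - fps_X))"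
  proof (rule cgr_dvdI)
    \<comment> \<open>Both sides are \<open>(q;q^2)_(K+1)\<close>, split at its first and at its
      last factor.\<close>
    have "Q * (1 - fps_X) = qpoch 1 1 2 K * (1 - fps_X ^ (1 + 2 * K))"
      using qpoch_Suc[of 1 1 2 K] qpoch_Suc_shift[of 1 1 2 K] by (simp add: Q_def eval_nat_numeral mult.commute)
    moreover have "inverse Q * Q = 1"
      using Q0 by (intro inverse_mult_eq_1) simp
    ultimately have "1 - fps_X = inverse Q * (qpoch 1 1 2 K * (1 - fps_X ^ (1 + 2 * K)))"
      by (rule mult_left_inverse_eq[rotated])
    hence "inverse Q * qpoch 1 1 2 K - (1 - fps_X) = inverse Q * qpoch 1 1 2 K * fps_X ^ (1 + 2 * K)"
      by (simp add: right_diff_distrib mult.assoc)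
    hence "fps_X ^ K dvd inverse Q * qpoch 1 1 2 K - (1 - fps_X)"
      by (simp add: le_imp_power_dvd)
    hence "fps_X ^ K dvd fps_const (1/2) * (inverse Q * qpoch 1 1 2 K - (1 - fps_X))"
      by (rule dvd_mult)
    thus "fps_X ^ K dvd fps_const (1/2) * inverse Q * qpoch 1 1 2 K * 1 - fps_const (1/2) * (1 - fps_X)"
      by (simp add: algebra_simps)
  qed
  finally show ?thesis .
qed (auto intro: cgr_dvdI)

theorem theorem1p3:
  shows "\<forall>m::int. \<exists>z::int. fls_nth (thm_lhs - thm_rhs) m = 4 * of_int z"
proof
  fix m :: int
  define R where "R = qpoch_inf (-1) 1 2 / qpoch_inf 1 3 2 * suminf thm_term"
  have inv: "fls_X_inv * (fls_const c * fls_X) = fls_const c" for c :: rat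
    by (rule fls_eqI) (simp add: fls_X_inv_times_conv_shift)
  have "thm_rhs = fls_X_inv * fps_to_fls (fps_const (1/2) * (1 - fps_X))"
    by (simp add: thm_rhs_def fls_times_fps_to_fls right_diff_distrib inv mult.commute[of fls_X_inv "fls_const _"])
  hence "thm_lhs - thm_rhs = fls_X_inv * fps_to_fls (R - fps_const (1/2) * (1 - fps_X))"
    by (simp add: thm_lhs_def R_def right_diff_distrib)
  \<comment> \<open>The factor 1/q shifts indices by one.\<close>
  hence nth: "fls_nth (thm_lhs - thm_rhs) m =
      (if m < -1 then 0 else (R - fps_const (1/2) * (1 - fps_X)) $ nat (m + 1))"
    by (simp add: fls_X_inv_times_conv_shift)
  show "\<exists>z::int. fls_nth (thm_lhs - thm_rhs) m = 4 * of_int z"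
  proof (cases "m < -1")
    case False
    \<comment> \<open>Truncating at \<open>q^(m+2)\<close> is just enough to see coefficient
      \<open>m + 1\<close>.\<close>
    thus ?thesis
      using cgr_nth[OF thm_series_cgr_4[of "Suc (nat (m + 1))"], of "nat (m + 1)"]
      unfolding nth R_def by (simp only: if_False) simp
  qed (auto simp only: nth if_True intro!: exI[of _ 0])
qed

end
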